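(* Consider the optimization problem over the variables $\delta,u,v,w,\alpha,\beta,\lambda^+,\lambda^-,\gamma,\mu$: $$\begin{aligned} \max\quad & -\sum_{k\in\mathcal K}\overline F_k\,(v_k\lambda_k^+ + v_k\lambda_k^-)-\sum_{g\in\mathcal G}\overline P_g u_g\gamma_g+\sum_{b\in\mathcal B}D_b\big((1-w_b)\alpha_b+\mu_b-\beta_b\big)\\ \text{s.t.}\quad &\sum_{r\in\mathcal R}\delta_r\le U\\ &\sum_{r\in\mathcal R_k}\delta_r\ge 1-v_k &&\forall k\in\mathcal K\\ &\sum_{r\in\mathcal R_g}\delta_r\ge 1-u_g &&\forall g\in\mathcal G\\ &\sum_{r\in\mathcal R_b}\delta_r\ge 1-w_b &&\forall b\in\mathcal B\\ &\delta_r\le 1-v_k &&\forall k\in\mathcal K,\ r\in\mathcal R_k\\ &\delta_r\le 1-u_g &&\forall g\in\mathcal G,\ r\in\mathcal R_g\\ &\delta_r\le 1-w_b &&\forall b\in\mathcal B,\ r\in\mathcal R_b\\ &\delta_r\in\{0,1\}\ \forall r\in\mathcal R,\quad v_k\in\{0,1\}\ \forall k\in\mathcal K,\quad u_g\in\{0,1\}\ \forall g\in\mathcal G,\quad w_b\in\{0,1\}\ \forall b\in\mathcal B\\ &\lambda_k^+-\lambda_k^-+\mu_{d(k)}-\mu_{o(k)}=0 &&\forall k\in\mathcal K\\ &\mu_{b(g)}-\gamma_g\le 0 &&\forall g\in\mathcal G\\ &\alpha_b+\mu_b-\beta_b\le 1 &&\forall b\in\mathcal B\\ &\alpha_b\ge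 0,\ \beta_b\ge 0\ \forall b\in\mathcal B,\quad \lambda_k^+\ge 0,\ \lambda_k^-\ge 0\ \forall k\in\mathcal K,\quad \gamma_g\ge 0\ \forall g\in\mathcal G. \end{aligned}$$ In this formulation it is valid (that is, it does not change the optimal value) to add the constraints $$-1\le\mu_b\le 1,\quad \alpha_b\le 1,\quad \beta_b\le 1\quad\forall b\in\mathcal B;\qquad \lambda_k^+\le 1,\quad \lambda_k^-\le 1\quad\forall k\in\mathcal K;\qquad \gamma_g\le 1\quad\forall g\in\mathcal G.$$
   Context: $\mathcal B$, $\mathcal K$, $\mathcal G$, $\mathcal R$ are finite sets of buses, transmission lines, generators and relays of a power network. Line $k$ has origin bus $o(k)$ and destination bus $d(k)$; generator $g$ is located at bus $b(g)$. $\mathcal R_k,\mathcal R_g,\mathcal R_b\subseteq\mathcal R$ are the sets of relays controlling line $k$, generator $g$, bus $b$, respectively (not necessarily disjoint). The parameters are the thermal limits $\overline F_k\ge 0$, generator capacities $\overline P_g\ge 0$, demands $D_b\ge 0$ and the attacker's budget $U\ge 0$. The variables $\alpha,\beta,\lambda^+,\lambda^-,\gamma,\mu$ are real-valued, with $\mu$ free in sign. The problem is the single-level reformulation, obtained by dualizing the inner problem, of the bilevel problem in which an attacker chooses $(\delta,u,v,w)$ and a defender then minimizes total load shed $\sum_b l_b$ over flows $f$, generation $p$ and load shed $l$ subject to $\sum_{k:\,d(k)=b}f_k-\sum_{k:\,o(k)=b}f_k+\sum_{g:\,b(g)=b}p_g+l_b=D_b$ and $D_b(1-w_b)\le l_b\le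 D_b$ for all $b$, $-\overline F_kv_k\le f_k\le\overline F_kv_k$ for all $k$, and $0\le p_g\le\overline P_gu_g$ for all $g$. *)

theory Defs
  imports Complex_Main "HOL-Library.Extended_Real"
begin

record ('b, 'k, 'g, 'r) network =
  buses :: "'b set"
  lines :: "'k set"
  gens :: "'g set"
  relays :: "'r set"
  orig :: "'k \<Rightarrow> 'b"
  dest :: "'k \<Rightarrow> 'b"
  gen_bus :: "'g \<Rightarrow> 'b"
  line_relays :: "'k \<Rightarrow> 'r set"
  gen_relays :: "'g \<Rightarrow> 'r set"
  bus_relays :: "'b \<Rightarrow> 'r set"
  line_limit :: "'k \<Rightarrow> real"
  gen_cap :: "'g \<Rightarrow> real"
  demand :: "'b \<Rightarrow> real"
  budget :: real

definition wf_network :: "('b, 'k, 'g, 'r) network \<Rightarrow> bool" where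
  "wf_network N \<longleftrightarrow>
     finite (buses N) \<and> finite (lines N) \<and> finite (gens N) \<and> finite (relays N) \<and>
     (\<forall>k\<in>lines N. orig N k \<in> buses N \<and> dest N k \<in> buses N) \<and>
     (\<forall>g\<in>gens N. gen_bus N g \<in> buses N) \<and>
     (\<forall>k\<in>lines N. line_relays N k \<subseteq> relays N) \<and>
     (\<forall>g\<in>gens N. gen_relays N g \<subseteq> relays N) \<and>
     (\<forall>b\<in>buses N. bus_relays N b \<subseteq> relays N) \<and>
     (\<forall>k\<in>lines N. line_limit N k \<ge> 0) \<and>
     (\<forall>g\<in>gens N. gen_cap N g \<ge> 0) \<and>
     (\<forall>b\<in>buses N. demand N b \<ge> 0) \<and>
     budget N \<ge> 0"

text \<open>
  The decision variables are total functions; only their values on the relevant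
  index sets of the network enter the constraints and the objective. The values
  1 of \<open>dv\<close>, \<open>du\<close>, \<open>dw\<close> mean that the line, generator or bus is left in service,
  whereas \<open>delta\<close> is 1 on the relays that are attacked.
\<close>

record ('b, 'k, 'g, 'r) point =
  delta :: "'r \<Rightarrow> real"
  du :: "'g \<Rightarrow> real"
  dv :: "'k \<Rightarrow> real"
  dw :: "'b \<Rightarrow> real"
  alpha :: "'b \<Rightarrow> real"
  beta :: "'b \<Rightarrow> real"
  lam_pos :: "'k \<Rightarrow> real"
  lam_neg :: "'k \<Rightarrow> real"
  gamma :: "'g \<Rightarrow> real"
  mu :: "'b \<Rightarrow> real"

definition objective :: "('b, 'k, 'g, 'r) network \<Rightarrow> ('b, 'k, 'g, 'r) point \<Rightarrow> real" where
  "objective N x =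
     - (\<Sum>k\<in>lines N. line_limit N k * (dv x k * lam_pos x k + dv x k * lam_neg x k))
     - (\<Sum>g\<in>gens N. gen_cap N g * du x g * gamma x g)
     + (\<Sum>b\<in>buses N. demand N b * ((1 - dw x b) * alpha x b + mu x b - beta x b))"

definition attack_feasible :: "('b, 'k, 'g, 'r) network \<Rightarrow> ('b, 'k, 'g, 'r) point \<Rightarrow> bool" where
  "attack_feasible N x \<longleftrightarrow>
     (\<Sum>r\<in>relays N. delta x r) \<le> budget N \<and>
     (\<forall>k\<in>lines N. (\<Sum>r\<in>line_relays N k. delta x r) \<ge> 1 - dv x k) \<and>
     (\<forall>g\<in>gens N. (\<Sum>r\<in>gen_relays N g. delta x r) \<ge> 1 - du x g) \<and>
     (\<forall>b\<in>buses N. (\<Sum>r\<in>bus_relays N b. delta x r) \<ge> 1 - dw x b) \<and>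
     (\<forall>k\<in>lines N. \<forall>r\<in>line_relays N k. delta x r \<le> 1 - dv x k) \<and>
     (\<forall>g\<in>gens N. \<forall>r\<in>gen_relays N g. delta x r \<le> 1 - du x g) \<and>
     (\<forall>b\<in>buses N. \<forall>r\<in>bus_relays N b. delta x r \<le> 1 - dw x b) \<and>
     (\<forall>r\<in>relays N. delta x r \<in> {0, 1}) \<and>
     (\<forall>k\<in>lines N. dv x k \<in> {0, 1}) \<and>
     (\<forall>g\<in>gens N. du x g \<in> {0, 1}) \<and>
     (\<forall>b\<in>buses N. dw x b \<in> {0, 1})"

definition dual_feasible :: "('b, 'k, 'g, 'r) network \<Rightarrow> ('b, 'k, 'g, 'r) point \<Rightarrow> bool" where
  "dual_feasible N x \<longleftrightarrow>
     (\<forall>k\<in>lines N. lam_pos x k - lam_neg x k + mu x (dest N k) - mu x (orig N k) = 0) \<and>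
     (\<forall>g\<in>gens N. mu x (gen_bus N g) - gamma x g \<le> 0) \<and>
     (\<forall>b\<in>buses N. alpha x b + mu x b - beta x b \<le> 1) \<and>
     (\<forall>b\<in>buses N. alpha x b \<ge> 0 \<and> beta x b \<ge> 0) \<and>
     (\<forall>k\<in>lines N. lam_pos x k \<ge> 0 \<and> lam_neg x k \<ge> 0) \<and>
     (\<forall>g\<in>gens N. gamma x g \<ge> 0)"

definition unit_bounds :: "('b, 'k, 'g, 'r) network \<Rightarrow> ('b, 'k, 'g, 'r) point \<Rightarrow> bool" where
  "unit_bounds N x \<longleftrightarrow>
     (\<forall>b\<in>buses N. -1 \<le> mu x b \<and> mu x b \<le> 1 \<and> alpha x b \<le> 1 \<and> beta x b \<le> 1) \<and>
     (\<forall>k\<in>lines N. lam_pos x k \<le> 1 \<and> lam_neg x k \<le> 1) \<and>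
     (\<forall>g\<in>gens N. gamma x g \<le> 1)"

definition feasible_set :: "('b, 'k, 'g, 'r) network \<Rightarrow> ('b, 'k, 'g, 'r) point set" where
  "feasible_set N = {x. attack_feasible N x \<and> dual_feasible N x}"

text \<open>
  The supremum is taken in the extended reals, so that the optimal value is
  meaningful without presupposing boundedness or feasibility.
\<close>

definition max_value :: "('x \<Rightarrow> real) \<Rightarrow> 'x set \<Rightarrow> ereal" where
  "max_value f S = (SUP x\<in>S. ereal (f x))"

end

theory Submission
  imports Defs
begin

text \<open>
  Truncating the bus prices \<open>mu\<close> to the interval from 0 to 1 never lowers the objective,
  provided that the other dual variables are then chosen as cheaply as the new prices permit.
  For fixed prices the best line multipliers are the positive and negative parts of the
  price difference, so a line in service costs its limit times the absolute price
  difference, which does not grow because truncation is 1-Lipschitz (lemma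
  \<open>clamp01_lipschitz\<close>). The best generator multiplier
  is the positive part of the price, which truncation does not increase. A bus in service
  earns at most its demand times the minimum of the price and 1, which is bounded
  by the truncated price; a bus out of service earns at most its demand, and attains it with
  \<open>alpha = 1 - mu\<close>. Lemma \<open>objective_truncate_prices_ge\<close> adds up these comparisons.

  Once the prices lie between 0 and 1, these choices put every dual variable between 0
  and 1. It matters that negative prices are raised to 0 and not just to -1: at a bus out of
  service with a negative price, \<open>alpha = 1 - mu\<close> would exceed 1. The attack is left
  untouched, so every feasible point is dominated by one obeying the bounds, and
  the suprema agree even where no maximum is known to exist.
\<close>

definition clamp01 :: "real \<Rightarrow> real" where
  "clamp01 t = max 0 (min 1 t)"

lemma clamp01_nonneg: "0 \<le> clamp01 t" and clamp01_le_1: "clamp01 t \<le> 1"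
  by (simp_all add: clamp01_def)

lemma clamp01_lipschitz: "\<bar>clamp01 s - clamp01 t\<bar> \<le> \<bar>s - t\<bar>"
  unfolding clamp01_def by linarith

definition truncate_prices :: "('b, 'k, 'g, 'r) network \<Rightarrow> ('b, 'k, 'g, 'r) point
    \<Rightarrow> ('b, 'k, 'g, 'r) point" where
  "truncate_prices N x = (let m = \<lambda>b. clamp01 (mu x b) in
     x\<lparr>mu := m,
       alpha := \<lambda>b. 1 - m b,
       beta := \<lambda>b. 0,
       lam_pos := \<lambda>k. max 0 (m (orig N k) - m (dest N k)),
       lam_neg := \<lambda>k. max 0 (m (dest N k) - m (orig N k)),
       gamma := \<lambda>g. m (gen_bus N g)\<rparr>)"

lemma truncate_prices_sel [simp]:
  "delta (truncate_prices N x) = delta x"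
  "du (truncate_prices N x) = du x"
  "dv (truncate_prices N x) = dv x"
  "dw (truncate_prices N x) = dw x"
  "mu (truncate_prices N x) b = clamp01 (mu x b)"
  "alpha (truncate_prices N x) b = 1 - clamp01 (mu x b)"
  "beta (truncate_prices N x) b = 0"
  "lam_pos (truncate_prices N x) k =
     max 0 (clamp01 (mu x (orig N k)) - clamp01 (mu x (dest N k)))"
  "lam_neg (truncate_prices N x) k =
     max 0 (clamp01 (mu x (dest N k)) - clamp01 (mu x (orig N k)))"
  "gamma (truncate_prices N x) g = clamp01 (mu x (gen_bus N g))"
  by (simp_all add: truncate_prices_def Let_def)

lemma attack_feasible_truncate_prices [simp]:
  "attack_feasible N (truncate_prices N x) \<longleftrightarrow> attack_feasible N x"
  by (simp add: attack_feasible_def)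

lemma dual_feasible_truncate_prices: "dual_feasible N (truncate_prices N x)"
  by (auto simp: dual_feasible_def clamp01_nonneg clamp01_le_1 max_def)

lemma unit_bounds_truncate_prices: "unit_bounds N (truncate_prices N x)"
proof -
  have "clamp01 s - clamp01 t \<le> 1" for s t
    using clamp01_nonneg[of t] clamp01_le_1[of s] by linarith
  moreover have "- 1 \<le> clamp01 t" for t
    using clamp01_nonneg[of t] by linarith
  ultimately show ?thesis
    by (simp add: unit_bounds_def clamp01_nonneg clamp01_le_1)
qed

text \<open>
  The comparison holds separately for every line, generator and bus. Line limits, generator
  capacities, demands and attack variables are nonnegative, so inequalities between
  multipliers carry over to objective terms. At a bus, \<open>dw\<close> being binary reduces the claim to
  the cases in service and out of service.
\<close>

lemma objective_truncate_prices_ge: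
  assumes wf: "wf_network N" and att: "attack_feasible N x" and dual: "dual_feasible N x"
  shows "objective N x \<le> objective N (truncate_prices N x)"
proof -
  let ?y = "truncate_prices N x"
  have line: "line_limit N k * (dv ?y k * lam_pos ?y k + dv ?y k * lam_neg ?y k)
      \<le> line_limit N k * (dv x k * lam_pos x k + dv x k * lam_neg x k)"
    if k: "k \<in> lines N" for k
  proof -
    have "lam_pos ?y k + lam_neg ?y k
        = \<bar>clamp01 (mu x (orig N k)) - clamp01 (mu x (dest N k))\<bar>"
      by simp
    also have "\<dots> \<le> \<bar>mu x (orig N k) - mu x (dest N k)\<bar>"
      by (rule clamp01_lipschitz)
    also have "\<dots> = \<bar>lam_pos x k - lam_neg x k\<bar>"
    proof -
      have "lam_pos x k - lam_neg x k + mu x (dest N k) - mu x (orig N k) = 0"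
        using dual k by (simp add: dual_feasible_def)
      then show ?thesis by linarith
    qed
    also have "\<dots> \<le> lam_pos x k + lam_neg x k"
    proof -
      have "0 \<le> lam_pos x k" "0 \<le> lam_neg x k"
        using dual k by (simp_all add: dual_feasible_def)
      then show ?thesis by linarith
    qed
    finally have "lam_pos ?y k + lam_neg ?y k \<le> lam_pos x k + lam_neg x k" .
    moreover have "0 \<le> dv x k"
      using att k by (auto simp: attack_feasible_def)
    moreover have "0 \<le> line_limit N k"
      using wf k by (simp add: wf_network_def)
    ultimately show ?thesis
      by (simp only: distrib_left[symmetric] truncate_prices_sel(3) mult_left_mono)
  qed
  have gen: "gen_cap N g * du ?y g * gamma ?y g \<le> gen_cap N g * du x g * gamma x g"
    if g: "g \<in> gens N" for g
  proof -
    have "mu x (gen_bus N g) - gamma x g \<le> 0" "0 \<le> gamma x g"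
      using dual g by (simp_all add: dual_feasible_def)
    then have "gamma ?y g \<le> gamma x g"
      by (simp add: clamp01_def)
    moreover have "0 \<le> du x g"
      using att g by (auto simp: attack_feasible_def)
    moreover have "0 \<le> gen_cap N g"
      using wf g by (simp add: wf_network_def)
    ultimately show ?thesis
      by (simp only: truncate_prices_sel(2) mult_left_mono mult_nonneg_nonneg)
  qed
  have bus: "demand N b * ((1 - dw x b) * alpha x b + mu x b - beta x b)
      \<le> demand N b * ((1 - dw ?y b) * alpha ?y b + mu ?y b - beta ?y b)"
    if b: "b \<in> buses N" for b
  proof -
    have d: "alpha x b + mu x b - beta x b \<le> 1" "0 \<le> alpha x b" "0 \<le> beta x b"
      using dual b by (simp_all add: dual_feasible_def)
    have "dw x b = 0 \<or> dw x b = 1"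
      using att b by (auto simp: attack_feasible_def)
    then have "(1 - dw x b) * alpha x b + mu x b - beta x b
        \<le> (1 - dw ?y b) * alpha ?y b + mu ?y b - beta ?y b"
      using d by (auto simp: clamp01_def)
    moreover have "0 \<le> demand N b"
      using wf b by (simp add: wf_network_def)
    ultimately show ?thesis
      by (rule mult_left_mono)
  qed
  show ?thesis
    unfolding objective_def
    by (intro add_mono diff_mono le_imp_neg_le sum_mono line gen bus)
qed

theorem mainTheorem3:
  fixes N :: "('b, 'k, 'g, 'r) network"
  assumes "wf_network N"
  shows "max_value (objective N) {x \<in> feasible_set N. unit_bounds N x}
       = max_value (objective N) (feasible_set N)"
proof (rule antisym)
  show "max_value (objective N) {x \<in> feasible_set N. unit_bounds N x}
      \<le> max_value (objective N) (feasible_set N)"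
    unfolding max_value_def by (rule SUP_subset_mono) auto
  show "max_value (objective N) (feasible_set N)
      \<le> max_value (objective N) {x \<in> feasible_set N. unit_bounds N x}"
    unfolding max_value_def
  proof (rule SUP_mono)
    fix x assume x: "x \<in> feasible_set N"
    have "truncate_prices N x \<in> {x \<in> feasible_set N. unit_bounds N x}"
      using x by (simp add: feasible_set_def dual_feasible_truncate_prices
          unit_bounds_truncate_prices)
    moreover have "ereal (objective N x) \<le> ereal (objective N (truncate_prices N x))"
      using objective_truncate_prices_ge[OF assms] x by (simp add: feasible_set_def)
    ultimately show "\<exists>y\<in>{x \<in> feasible_set N. unit_bounds N x}.
        ereal (objective N x) \<le> ereal (objective N y)"
      by blast
  qed
qed

end
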